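(* Let $\Omega\subset\mathbb{R}^N$ be a domain, $0<p\le2$ and $C\ge0$. Let $u\in\mathrm{LSC}(\Omega)$ be a locally bounded viscosity supersolution of $$-\lambda_N(D^2u)+|Du|^p=-C\quad\text{in }\Omega.$$ Then for any open sets $\omega\subset\subset\omega'\subset\subset\Omega$ there exists a positive constant $L$, depending only on $p$, $C$, $\mathrm{dist}(\omega,\partial\omega')$ and $\|u\|_{L^\infty(\omega')}$, such that $$|u(x)-u(y)|\le L|x-y|\quad\text{for all }x,y\in\omega.$$
   Context: $A\subset\subset B$ means that $\overline A$ is compact and contained in $B$. For a real symmetric $N\times N$ matrix $X$, $\lambda_N(X)$ denotes its largest eigenvalue. $\mathrm{LSC}(\Omega)$ is the set of real-valued lower semicontinuous functions on $\Omega$; $\|u\|_{L^\infty(\omega')}$ is the supremum of $|u|$ over $\omega'$. A function $u\in\mathrm{LSC}(\Omega)$ is a viscosity supersolution of $-\lambda_N(D^2u)+|Du|^p=-C$ in $\Omega$ if, whenever $\varphi$ is $C^2$ and $u-\varphi$ has a local minimum at $x\in\Omega$, one has $-\lambda_N(D^2\varphi(x))+|D\varphi(x)|^p\ge -C$. *)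

theory Defs
  imports
    "HOL-Analysis.Derivative"
    "HOL-Analysis.L2_Norm"
    "HOL-Analysis.Abstract_Euclidean_Space"
    "Jordan_Normal_Form.Char_Poly"
begin

text \<open>
  The Lipschitz constant of the theorem must not depend on the dimension \<open>N\<close>, so \<open>N\<close> is
  quantified inside an existential and cannot be a type. Points of \<open>\<real>\<^sup>N\<close> are therefore the functions
  \<open>x :: nat \<Rightarrow> real\<close> with \<open>x i = 0\<close> for all \<open>i \<ge> N\<close>, carrying the library's topology
  \<^const>\<open>Euclidean_space\<close>.
\<close>

definition edist :: "nat \<Rightarrow> (nat \<Rightarrow> real) \<Rightarrow> (nat \<Rightarrow> real) \<Rightarrow> real" where
  "edist N x y = L2_set (\<lambda>i. x i - y i) {..<N}"

text \<open>Only meaningful for nonempty sets: \<open>Inf {}\<close> is unspecified on \<^typ>\<open>real\<close>.\<close>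

definition esetdist :: "nat \<Rightarrow> (nat \<Rightarrow> real) set \<Rightarrow> (nat \<Rightarrow> real) set \<Rightarrow> real" where
  "esetdist N A B = Inf {edist N x y | x y. x \<in> A \<and> y \<in> B}"

definition compactly_contained :: "nat \<Rightarrow> (nat \<Rightarrow> real) set \<Rightarrow> (nat \<Rightarrow> real) set \<Rightarrow> bool" where
  "compactly_contained N A B \<longleftrightarrow>
     compactin (Euclidean_space N) (Euclidean_space N closure_of A) \<and>
     Euclidean_space N closure_of A \<subseteq> B"

definition domain_in :: "nat \<Rightarrow> (nat \<Rightarrow> real) set \<Rightarrow> bool" where
  "domain_in N \<Omega> \<longleftrightarrow>
     \<Omega> \<noteq> {} \<and> openin (Euclidean_space N) \<Omega> \<and> connectedin (Euclidean_space N) \<Omega>"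

definition LSC :: "nat \<Rightarrow> (nat \<Rightarrow> real) set \<Rightarrow> ((nat \<Rightarrow> real) \<Rightarrow> real) set" where
  "LSC N \<Omega> = {u. \<forall>c. openin (subtopology (Euclidean_space N) \<Omega>) {x \<in> \<Omega>. c < u x}}"

definition locally_bounded_on :: "nat \<Rightarrow> (nat \<Rightarrow> real) set \<Rightarrow> ((nat \<Rightarrow> real) \<Rightarrow> real) \<Rightarrow> bool" where
  "locally_bounded_on N \<Omega> u \<longleftrightarrow>
     (\<forall>x\<in>\<Omega>. \<exists>U. openin (Euclidean_space N) U \<and> x \<in> U \<and> U \<subseteq> \<Omega> \<and> bounded (u ` U))"

definition partial_deriv :: "nat \<Rightarrow> ((nat \<Rightarrow> real) \<Rightarrow> real) \<Rightarrow> (nat \<Rightarrow> real) \<Rightarrow> real" where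
  "partial_deriv i \<phi> x = deriv (\<lambda>t. \<phi> (x(i := t))) (x i)"

text \<open>\<open>C\<^sup>1\<close> and \<open>C\<^sup>2\<close> through existence and continuity of the partial derivatives;
  both are intended for open \<open>\<Omega>\<close>.\<close>

definition C1_on :: "nat \<Rightarrow> (nat \<Rightarrow> real) set \<Rightarrow> ((nat \<Rightarrow> real) \<Rightarrow> real) \<Rightarrow> bool" where
  "C1_on N \<Omega> \<phi> \<longleftrightarrow>
     continuous_map (subtopology (Euclidean_space N) \<Omega>) euclideanreal \<phi> \<and>
     (\<forall>i<N. (\<forall>x\<in>\<Omega>. (\<lambda>t. \<phi> (x(i := t))) differentiable at (x i)) \<and>
            continuous_map (subtopology (Euclidean_space N) \<Omega>) euclideanreal (partial_deriv i \<phi>))"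

definition C2_on :: "nat \<Rightarrow> (nat \<Rightarrow> real) set \<Rightarrow> ((nat \<Rightarrow> real) \<Rightarrow> real) \<Rightarrow> bool" where
  "C2_on N \<Omega> \<phi> \<longleftrightarrow> C1_on N \<Omega> \<phi> \<and> (\<forall>i<N. C1_on N \<Omega> (partial_deriv i \<phi>))"

definition grad_norm :: "nat \<Rightarrow> ((nat \<Rightarrow> real) \<Rightarrow> real) \<Rightarrow> (nat \<Rightarrow> real) \<Rightarrow> real" where
  "grad_norm N \<phi> x = L2_set (\<lambda>i. partial_deriv i \<phi> x) {..<N}"

definition hessian :: "nat \<Rightarrow> ((nat \<Rightarrow> real) \<Rightarrow> real) \<Rightarrow> (nat \<Rightarrow> real) \<Rightarrow> real mat" where
  "hessian N \<phi> x = Matrix.mat N N (\<lambda>(i, j). partial_deriv i (partial_deriv j \<phi>) x)"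

text \<open>For a real symmetric matrix of positive size the set of eigenvalues is finite and nonempty.\<close>

definition largest_eigenvalue :: "real mat \<Rightarrow> real" where
  "largest_eigenvalue X = Max {k. eigenvalue X k}"

definition local_min_at ::
  "nat \<Rightarrow> (nat \<Rightarrow> real) set \<Rightarrow> ((nat \<Rightarrow> real) \<Rightarrow> real) \<Rightarrow> (nat \<Rightarrow> real) \<Rightarrow> bool" where
  "local_min_at N \<Omega> f x \<longleftrightarrow>
     (\<exists>U. openin (Euclidean_space N) U \<and> x \<in> U \<and> U \<subseteq> \<Omega> \<and> (\<forall>y\<in>U. f x \<le> f y))"

text \<open>Supersolutions of \<open>-\<lambda>\<^sub>N(D\<^sup>2u) + |Du|\<^sup>p = -C\<close> in \<open>\<Omega>\<close>; test functions are \<open>C\<^sup>2\<close> on all of \<open>\<Omega>\<close>.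
  Since \<open>p > 0\<close> is assumed where this is used, the convention \<open>0 powr p = 0\<close> is the right one.\<close>

definition viscosity_supersolution ::
  "nat \<Rightarrow> real \<Rightarrow> real \<Rightarrow> (nat \<Rightarrow> real) set \<Rightarrow> ((nat \<Rightarrow> real) \<Rightarrow> real) \<Rightarrow> bool" where
  "viscosity_supersolution N p C \<Omega> u \<longleftrightarrow>
     (\<forall>\<phi>. C2_on N \<Omega> \<phi> \<longrightarrow>
       (\<forall>x\<in>\<Omega>. local_min_at N \<Omega> (\<lambda>y. u y - \<phi> y) x \<longrightarrow>
          - largest_eigenvalue (hessian N \<phi> x) + grad_norm N \<phi> x powr p \<ge> - C))"

definition sup_norm :: "(nat \<Rightarrow> real) set \<Rightarrow> ((nat \<Rightarrow> real) \<Rightarrow> real) \<Rightarrow> real" where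
  "sup_norm A u = (SUP x\<in>A. \<bar>u x\<bar>)"

end

theory Submission
  imports Defs
begin

text \<open>
  A supersolution satisfies \<open>\<lambda>\<^sub>N(D\<^sup>2\<phi>) \<le> |D\<phi>|\<^sup>p + C\<close> wherever a test function \<open>\<phi>\<close> touches it from
  below. Hence no cone that opens downwards, and is sufficiently convex along its rays, can touch \<open>u\<close> from
  below away from its vertex. The barrier is \<open>-w(|z - x|)\<close> with \<open>w(r) = ln (1 + r/\<epsilon>) / 4\<close>. In the
  radial direction its second derivative is \<open>1 / (4(\<epsilon> + r)\<^sup>2)\<close>, which exceeds the square
  \<open>1 / (16(\<epsilon> + r)\<^sup>2)\<close> of its slope by more than \<open>C + 1\<close> as long as \<open>\<epsilon> + r\<close> is small. Because
  \<open>p \<le> 2\<close>, the \<open>p\<close>-th power of the slope is at most its square plus 1, and the barrier violates the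
  inequality. The logarithm is what makes the estimate possible: on a ball whose radius \<open>R\<close> is
  limited by \<open>C\<close> and the distance \<open>d\<close>, the value \<open>w(R)\<close> becomes as large as one likes when
  \<open>\<epsilon> \<rightarrow> 0\<close>, in particular larger than the oscillation \<open>2M\<close> of \<open>u\<close>.

  The lower semicontinuous function \<open>u(z) + w(|z - x|)\<close> therefore attains its minimum over the closed
  ball of radius \<open>R\<close> at the centre \<open>x\<close>: another interior point is excluded by
  \<open>supersolution_no_interior_contact\<close>, and a point of the sphere by \<open>w(R) \<ge> 2M\<close>. This gives
  \<open>u(x) - u(y) \<le> w(|x - y|) \<le> |x - y| / (4\<epsilon>)\<close> for \<open>|x - y| \<le> R\<close>
  (\<open>supersolution_one_sided_bound\<close>); for points farther apart the bound \<open>|u| \<le> M\<close> suffices, and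
  exchanging \<open>x\<close> and \<open>y\<close> gives the absolute value.

  The barrier is singular at its vertex, while test functions have to be \<open>C\<^sup>2\<close> on the whole domain. So
  at a contact point the barrier is bounded from below by a quadratic polynomial with the same value
  and gradient and with half the radial convexity (\<open>ln_barrier_le_quadratic\<close>). The Hessian
  of that polynomial has the radial direction as an eigenvector, so the largest eigenvalue can be
  estimated from below without a variational characterisation (\<open>supersolution_quadratic\<close>).
\<close>

section \<open>Quadratic test functions\<close>

definition offset_along :: "nat \<Rightarrow> (nat \<Rightarrow> real) \<Rightarrow> (nat \<Rightarrow> real) \<Rightarrow> (nat \<Rightarrow> real) \<Rightarrow> real" where
  "offset_along N e a x = (\<Sum>j<N. (x j - a j) * e j)"

text \<open>
  The polynomial \<open>\<alpha>t + \<beta>t\<^sup>2 - \<gamma>|x - a|\<^sup>2\<close> with \<open>t = \<langle>x - a, e\<rangle>\<close>. For a unit vector \<open>e\<close> its gradient at \<open>a\<close> is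
  \<open>\<alpha>e\<close> and its Hessian is \<open>2\<beta> e\<otimes>e - 2\<gamma>I\<close>; the part with \<open>\<gamma>\<close> absorbs the curvature of a radial
  function in the directions tangent to the sphere.
\<close>

definition quadratic_test ::
  "nat \<Rightarrow> (nat \<Rightarrow> real) \<Rightarrow> (nat \<Rightarrow> real) \<Rightarrow> real \<Rightarrow> real \<Rightarrow> real \<Rightarrow> (nat \<Rightarrow> real) \<Rightarrow> real" where
  "quadratic_test N e a \<alpha> \<beta> \<gamma> x =
     \<alpha> * offset_along N e a x + \<beta> * (offset_along N e a x)\<^sup>2 - \<gamma> * (\<Sum>j<N. (x j - a j)\<^sup>2)"

lemma continuous_map_coordinate:
  "continuous_map (Euclidean_space N) euclideanreal (\<lambda>x. x i)"
  unfolding Euclidean_space_def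
  by (intro continuous_map_from_subtopology continuous_map_product_projection) simp

lemma continuous_map_offset_along:
  "continuous_map (Euclidean_space N) euclideanreal (offset_along N e a)"
  unfolding offset_along_def
  by (intro continuous_intros continuous_map_coordinate) auto

lemma continuous_map_edist:
  "continuous_map (Euclidean_space N) euclideanreal (edist N a)"
  unfolding edist_def L2_set_def
  by (intro continuous_intros continuous_map_coordinate) auto

lemma edist_sq: "(edist N x y)\<^sup>2 = (\<Sum>j<N. (y j - x j)\<^sup>2)"
  by (simp add: edist_def L2_set_def sum_nonneg power2_commute)

lemma edist_nonneg: "0 \<le> edist N x y"
  by (simp add: edist_def)

lemma edist_commute: "edist N x y = edist N y x"
  by (simp add: edist_def L2_set_def power2_commute)

lemma edist_eq_0_iff:
  assumes "x \<in> topspace (Euclidean_space N)" "y \<in> topspace (Euclidean_space N)"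
  shows "edist N x y = 0 \<longleftrightarrow> x = y"
proof
  assume "edist N x y = 0"
  then have "x i = y i" for i
    using assms by (cases "i < N") (auto simp: edist_def L2_set_eq_0_iff topspace_Euclidean_space)
  then show "x = y" by blast
qed (simp add: edist_def L2_set_def)

lemma offset_along_sq_le:
  assumes "(\<Sum>j<N. (e j)\<^sup>2) = 1"
  shows "(offset_along N e a x)\<^sup>2 \<le> (edist N a x)\<^sup>2"
  unfolding offset_along_def edist_sq
  using Cauchy_Schwarz_ineq_sum[of "\<lambda>j. x j - a j" e "{..<N}"] assms by simp

lemma partial_deriv_eqI:
  assumes "\<And>x. ((\<lambda>t. \<phi> (x(i := t))) has_real_derivative g x) (at (x i))"
  shows "partial_deriv i \<phi> = g"
  by (rule ext) (simp add: partial_deriv_def DERIV_imp_deriv[OF assms])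

text \<open>
  If the derivatives in the coordinates exist everywhere and are given by continuous functions, they
  are the partial derivatives as functions, which allows \<open>C1_on\<close> to be iterated.
\<close>

lemma C1_onI:
  assumes "continuous_map (Euclidean_space N) euclideanreal \<phi>"
    and der: "\<And>i x. i < N \<Longrightarrow> ((\<lambda>t. \<phi> (x(i := t))) has_real_derivative g i x) (at (x i))"
    and "\<And>i. i < N \<Longrightarrow> continuous_map (Euclidean_space N) euclideanreal (g i)"
  shows "C1_on N \<Omega> \<phi>"
proof -
  have "partial_deriv i \<phi> = g i" if "i < N" for i
    by (rule partial_deriv_eqI) (rule der[OF that])
  moreover have "(\<lambda>t. \<phi> (x(i := t))) differentiable at (x i)" if "i < N" for i x
    using der[OF that] by (auto simp: real_differentiable_def)
  ultimately show ?thesis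
    using assms unfolding C1_on_def by (simp add: continuous_map_from_subtopology)
qed

lemma offset_along_upd:
  assumes "i < N"
  shows "offset_along N e a (x(i := t)) = offset_along N e a x + (t - x i) * e i"
proof -
  have "offset_along N e a (x(i := t)) - offset_along N e a x = (\<Sum>j<N. if j = i then (t - x i) * e i else 0)"
    unfolding offset_along_def sum_subtractf[symmetric] by (rule sum.cong) (auto simp: algebra_simps)
  then show ?thesis using assms by simp
qed

lemma sum_sq_upd:
  fixes x :: "nat \<Rightarrow> real"
  assumes "i < N"
  shows "(\<Sum>j<N. ((x(i := t)) j - a j)\<^sup>2) = (\<Sum>j<N. (x j - a j)\<^sup>2) + (t - a i)\<^sup>2 - (x i - a i)\<^sup>2"
proof -
  have "(\<Sum>j<N. ((x(i := t)) j - a j)\<^sup>2) - (\<Sum>j<N. (x j - a j)\<^sup>2)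
      = (\<Sum>j<N. if j = i then (t - a i)\<^sup>2 - (x i - a i)\<^sup>2 else 0)"
    unfolding sum_subtractf[symmetric] by (rule sum.cong) (auto simp: algebra_simps)
  then show ?thesis using assms by simp
qed

lemma quadratic_test_deriv:
  assumes "i < N"
  shows "((\<lambda>t. quadratic_test N e a \<alpha> \<beta> \<gamma> (x(i := t))) has_real_derivative
     \<alpha> * e i + 2 * \<beta> * offset_along N e a x * e i - 2 * \<gamma> * (x i - a i)) (at (x i))"
  unfolding quadratic_test_def offset_along_upd[OF assms] sum_sq_upd[OF assms]
  by (auto intro!: derivative_eq_intros simp: algebra_simps)

lemma quadratic_test_deriv2:
  assumes "i < N"
  shows "((\<lambda>t. \<alpha> * e j + 2 * \<beta> * offset_along N e a (x(i := t)) * e j - 2 * \<gamma> * ((x(i := t)) j - a j))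
      has_real_derivative 2 * \<beta> * e i * e j - (if i = j then 2 * \<gamma> else 0)) (at (x i))"
  unfolding offset_along_upd[OF assms]
  by (cases "i = j") (auto intro!: derivative_eq_intros simp: algebra_simps)

lemma partial_deriv_quadratic_test:
  assumes "i < N"
  shows "partial_deriv i (quadratic_test N e a \<alpha> \<beta> \<gamma>) =
    (\<lambda>x. \<alpha> * e i + 2 * \<beta> * offset_along N e a x * e i - 2 * \<gamma> * (x i - a i))"
  by (rule partial_deriv_eqI) (rule quadratic_test_deriv[OF assms])

lemma C2_quadratic_test: "C2_on N \<Omega> (quadratic_test N e a \<alpha> \<beta> \<gamma>)"
proof -
  have "C1_on N \<Omega> (quadratic_test N e a \<alpha> \<beta> \<gamma>)"
  proof (rule C1_onI[OF _ quadratic_test_deriv])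
    show "continuous_map (Euclidean_space N) euclideanreal (quadratic_test N e a \<alpha> \<beta> \<gamma>)"
      unfolding quadratic_test_def
      by (intro continuous_intros continuous_map_offset_along continuous_map_coordinate) auto
  qed (auto intro!: continuous_intros continuous_map_offset_along continuous_map_coordinate)
  moreover have "C1_on N \<Omega> (partial_deriv j (quadratic_test N e a \<alpha> \<beta> \<gamma>))" if "j < N" for j
    unfolding partial_deriv_quadratic_test[OF that]
    by (rule C1_onI[OF _ quadratic_test_deriv2])
      (auto intro!: continuous_intros continuous_map_offset_along continuous_map_coordinate)
  ultimately show ?thesis by (simp add: C2_on_def)
qed

text \<open>
  The maximum in \<open>largest_eigenvalue\<close> bounds its members because the eigenvalues, being roots of
  the monic characteristic polynomial, are finitely many.
\<close>

lemma eigenvalue_le_largest: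
  assumes "X \<in> carrier_mat n n" and "eigenvalue X k"
  shows "k \<le> largest_eigenvalue X"
proof -
  have "char_poly X \<noteq> 0"
    using degree_monic_char_poly[OF assms(1)] by auto
  then have "finite {k. eigenvalue X k}"
    by (simp add: eigenvalue_root_char_poly[OF assms(1)] poly_roots_finite)
  then show ?thesis unfolding largest_eigenvalue_def using assms(2) by simp
qed

text \<open>
  The vector \<open>e\<close> is an eigenvector of \<open>2\<beta> e\<otimes>e - 2\<gamma>I\<close> for the eigenvalue \<open>2(\<beta> - \<gamma>)\<close>, and the
  gradient \<open>\<alpha>e\<close> at the contact point has norm \<open>|\<alpha>|\<close>.
\<close>

lemma supersolution_quadratic:
  assumes visc: "viscosity_supersolution N p C \<Omega> u"
    and U: "openin (Euclidean_space N) U" "a \<in> U" "U \<subseteq> \<Omega>"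
    and unit: "(\<Sum>j<N. (e j)\<^sup>2) = 1"
    and touch: "\<And>y. y \<in> U \<Longrightarrow> u a + quadratic_test N e a \<alpha> \<beta> \<gamma> y \<le> u y"
  shows "2 * (\<beta> - \<gamma>) \<le> \<bar>\<alpha>\<bar> powr p + C"
proof -
  let ?q = "quadratic_test N e a \<alpha> \<beta> \<gamma>"
  let ?H = "hessian N ?q a"
  let ?v = "Matrix.vec N e"
  have H: "?H = Matrix.mat N N (\<lambda>(i, j). 2 * \<beta> * e i * e j - (if i = j then 2 * \<gamma> else 0))"
    unfolding hessian_def
  proof (rule Matrix.cong_mat[OF refl refl])
    fix i j assume ij: "i < N" "j < N"
    show "(case (i, j) of (i, j) \<Rightarrow> partial_deriv i (partial_deriv j ?q) a)
        = (case (i, j) of (i, j) \<Rightarrow> 2 * \<beta> * e i * e j - (if i = j then 2 * \<gamma> else 0))"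
      unfolding partial_deriv_quadratic_test[OF ij(2)] split_conv
      by (subst partial_deriv_eqI[OF quadratic_test_deriv2[OF ij(1)]]) (rule refl)
  qed
  have "?H *\<^sub>v ?v = (2 * (\<beta> - \<gamma>)) \<cdot>\<^sub>v ?v"
  proof (rule Matrix.eq_vecI)
    fix i assume "i < dim_vec ((2 * (\<beta> - \<gamma>)) \<cdot>\<^sub>v ?v)"
    then have i: "i < N" by simp
    have "Matrix.vec_index (?H *\<^sub>v ?v) i = (\<Sum>j<N. (2 * \<beta> * e i * e j - (if i = j then 2 * \<gamma> else 0)) * e j)"
      using i by (simp add: H scalar_prod_def lessThan_atLeast0)
    also have "\<dots> = (\<Sum>j<N. 2 * \<beta> * e i * (e j)\<^sup>2 - (if i = j then 2 * \<gamma> * e j else 0))"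
      by (rule sum.cong) (auto simp: algebra_simps power2_eq_square)
    also have "\<dots> = 2 * \<beta> * e i - 2 * \<gamma> * e i"
      using i unit by (simp add: sum_subtractf flip: sum_distrib_left)
    finally show "Matrix.vec_index (?H *\<^sub>v ?v) i = Matrix.vec_index ((2 * (\<beta> - \<gamma>)) \<cdot>\<^sub>v ?v) i"
      using i by (simp add: algebra_simps)
  qed (simp add: H)
  moreover have "?v \<noteq> 0\<^sub>v N"
  proof
    assume "?v = 0\<^sub>v N"
    then have "e j = 0" if "j < N" for j using that by (metis index_vec index_zero_vec(1))
    then show False using unit by simp
  qed
  ultimately have "eigenvalue ?H (2 * (\<beta> - \<gamma>))"
    unfolding eigenvalue_def eigenvector_def by (intro exI[of _ ?v]) (simp add: H)
  then have 1: "2 * (\<beta> - \<gamma>) \<le> largest_eigenvalue ?H"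
    by (rule eigenvalue_le_largest[rotated, where n = N]) (simp add: H)
  have "grad_norm N ?q a = L2_set (\<lambda>i. \<alpha> * e i) {..<N}"
    unfolding grad_norm_def
    by (rule L2_set_cong) (auto simp: partial_deriv_quadratic_test offset_along_def)
  also have "\<dots> = \<bar>\<alpha>\<bar>"
    using unit by (simp add: L2_set_def power_mult_distrib flip: sum_distrib_left)
  finally have 2: "grad_norm N ?q a = \<bar>\<alpha>\<bar>" .
  have "?q a = 0" by (simp add: quadratic_test_def offset_along_def)
  then have "local_min_at N \<Omega> (\<lambda>y. u y - ?q y) a"
    unfolding local_min_at_def using U touch by (intro exI[of _ U]) force
  then have "- largest_eigenvalue ?H + grad_norm N ?q a powr p \<ge> - C"
    using visc C2_quadratic_test U unfolding viscosity_supersolution_def by blast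
  then show ?thesis using 1 2 by simp
qed

section \<open>The barrier\<close>

text \<open>
  The difference of the two sides has derivative \<open>s(1 - s) / (2(1 + s))\<close>, so it decreases up to \<open>0\<close>,
  where it vanishes, and increases afterwards. Half of the quadratic Taylor coefficient is given up
  so that the inequality holds on both sides of \<open>0\<close>.
\<close>

lemma ln_add_one_le_quadratic:
  fixes s :: real
  assumes "\<bar>s\<bar> \<le> 1/2"
  shows "ln (1 + s) \<le> s - s\<^sup>2 / 4"
proof -
  define g where "g = (\<lambda>s::real. s - s\<^sup>2 / 4 - ln (1 + s))"
  have der: "(g has_real_derivative s * (1 - s) / (2 * (1 + s))) (at s)" if "\<bar>s\<bar> \<le> 1/2" for s
  proof -
    have "1 + s > 0" using that by linarith
    then show ?thesis unfolding g_def
      by (auto intro!: derivative_eq_intros simp: field_simps power2_eq_square)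
  qed
  have "g 0 \<le> g s"
  proof (cases "0 \<le> s")
    case True
    show ?thesis
    proof (rule DERIV_nonneg_imp_nondecreasing[OF True, where f = g])
      fix x assume "0 \<le> x" "x \<le> s"
      then show "\<exists>y. (g has_real_derivative y) (at x) \<and> 0 \<le> y"
        using assms by (intro exI[of _ "x * (1 - x) / (2 * (1 + x))"] conjI der) auto
    qed
  next
    case False
    show ?thesis
    proof (rule DERIV_nonpos_imp_nonincreasing[where f = g])
      show "s \<le> 0" using False by simp
      fix x assume "s \<le> x" "x \<le> 0"
      then show "\<exists>y. (g has_real_derivative y) (at x) \<and> y \<le> 0"
        using assms by (intro exI[of _ "x * (1 - x) / (2 * (1 + x))"] conjI der)
          (auto intro!: divide_nonpos_pos mult_nonpos_nonneg)
    qed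
  qed
  then show ?thesis by (simp add: g_def)
qed

text \<open>
  Here \<open>r\<close> is the distance from the vertex to a point near the contact point \<open>y\<close>, which lies at
  distance \<open>s\<close> from the vertex; \<open>t\<close> is the radial component and \<open>D\<close> the squared length of the offset
  from \<open>y\<close>, and \<open>\<rho> = \<epsilon> + s\<close>. The tangential part of the offset has squared length \<open>D - t\<^sup>2\<close>, and
  \<open>r \<le> s + t + (D - t\<^sup>2)/s\<close>: it lengthens \<open>r\<close> only to second order. So the radial part enters the
  logarithm as \<open>1 + t/\<rho>\<close>, where the concavity of \<open>ln\<close> is kept, and the tangential part is estimated
  linearly.
\<close>

lemma ln_barrier_le_quadratic:
  fixes \<rho> s t D r :: real
  assumes s: "0 < s" "s \<le> \<rho>" and t: "\<bar>t\<bar> \<le> s / 2" and D: "t\<^sup>2 \<le> D"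
    and r: "0 \<le> r" "r\<^sup>2 = s\<^sup>2 + 2 * s * t + D"
  shows "ln ((\<rho> - s + r) / \<rho>) \<le> t / \<rho> - t\<^sup>2 / (4 * \<rho>\<^sup>2) + 2 * (D - t\<^sup>2) / (s * \<rho>)"
proof -
  define b where "b = (D - t\<^sup>2) / s"
  have b: "0 \<le> b" using D s by (simp add: b_def)
  have bs: "D = t\<^sup>2 + b * s" using s by (simp add: b_def)
  have rho: "0 < \<rho>" using s by linarith
  \<comment> \<open>As \<open>s + t \<ge> s/2\<close>, the cross term \<open>2(s + t)b\<close> is at least \<open>s b = D - t\<^sup>2\<close>.\<close>
  have "r\<^sup>2 \<le> (s + t + b)\<^sup>2"
  proof -
    have "0 \<le> b * (s + 2 * t)" using b t by (intro mult_nonneg_nonneg) auto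
    moreover have "0 \<le> b\<^sup>2" by simp
    ultimately show ?thesis unfolding r(2) bs by (simp add: power2_eq_square algebra_simps)
  qed
  then have rle: "r \<le> s + t + b" using b t s by (intro power2_le_imp_le[of r]) auto
  have t': "\<bar>t / \<rho>\<bar> \<le> 1/2" using t s rho by (simp add: field_simps)
  have pos: "0 < 1 + t / \<rho>" "1/2 \<le> 1 + t / \<rho>" using t' by linarith+
  have bp: "0 \<le> b / \<rho>" using b rho by simp
  have rp: "0 < \<rho> - s + r"
  proof (cases "r = 0")
    case True
    then have "(s + t)\<^sup>2 + b * s = 0" using r(2) bs by (simp add: power2_eq_square algebra_simps)
    moreover have "0 \<le> b * s" using b s by simp
    ultimately have "s + t = 0" by (smt (verit) zero_le_power2 power_eq_0_iff)
    then show ?thesis using t s by linarith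
  qed (use r s in linarith)
  have "ln ((\<rho> - s + r) / \<rho>) \<le> ln ((1 + t / \<rho>) * (1 + b / \<rho> / (1 + t / \<rho>)))"
  proof -
    have "(1 + t / \<rho>) * (1 + b / \<rho> / (1 + t / \<rho>)) = (\<rho> + t + b) / \<rho>"
      using pos(1) by (simp only: distrib_left mult_1_right times_divide_eq_right nonzero_mult_div_cancel_left[OF less_imp_neq[OF pos(1), symmetric]])
        (use rho in \<open>simp add: add_divide_distrib\<close>)
    moreover have "(\<rho> - s + r) / \<rho> \<le> (\<rho> + t + b) / \<rho>"
      using rle rho by (intro divide_right_mono) auto
    moreover have "0 < (\<rho> - s + r) / \<rho>" using rp rho by simp
    ultimately show ?thesis by (metis ln_mono)
  qed
  also have "\<dots> = ln (1 + t / \<rho>) + ln (1 + b / \<rho> / (1 + t / \<rho>))"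
    using pos(1) divide_nonneg_pos[OF bp pos(1)] by (intro ln_mult_pos) auto
  also have "\<dots> \<le> (t / \<rho> - (t / \<rho>)\<^sup>2 / 4) + b / \<rho> / (1 + t / \<rho>)"
    using ln_add_one_le_quadratic[OF t'] divide_nonneg_pos[OF bp pos(1)]
    by (intro add_mono ln_add_one_self_le_self)
  also have "b / \<rho> / (1 + t / \<rho>) \<le> b / \<rho> / (1 / 2)"
    by (intro divide_left_mono mult_pos_pos pos bp) simp
  also have "(t / \<rho> - (t / \<rho>)\<^sup>2 / 4) + b / \<rho> / (1 / 2)
      = t / \<rho> - t\<^sup>2 / (4 * \<rho>\<^sup>2) + 2 * (D - t\<^sup>2) / (s * \<rho>)"
    by (simp add: b_def power_divide algebra_simps)
  finally show ?thesis by simp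
qed

section \<open>Topology\<close>

text \<open>
  If no point were minimal, the sets where \<open>f\<close> exceeds one of its values would cover \<open>K\<close>; in a finite
  subcover the point with the smallest value is not covered.
\<close>

lemma lsc_attains_min:
  fixes f :: "'a \<Rightarrow> real"
  assumes K: "compactin X K" "K \<noteq> {}"
    and lsc: "\<And>c. openin (subtopology X K) {x \<in> K. c < f x}"
  shows "\<exists>x\<in>K. \<forall>y\<in>K. f x \<le> f y"
proof (rule ccontr)
  assume "\<not> ?thesis"
  then have *: "\<forall>x\<in>K. \<exists>y\<in>K. f y < f x" by force
  have "compactin (subtopology X K) K" using K by (simp add: compactin_subtopology)
  moreover have "K \<subseteq> \<Union>((\<lambda>y. {x \<in> K. f y < f x}) ` K)" using * by blast
  moreover have "openin (subtopology X K) U" if "U \<in> (\<lambda>y. {x \<in> K. f y < f x}) ` K" for U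
    using that lsc by auto
  ultimately obtain \<F> where F: "finite \<F>" "\<F> \<subseteq> (\<lambda>y. {x \<in> K. f y < f x}) ` K" "K \<subseteq> \<Union>\<F>"
    using compactinD[of "subtopology X K" K "(\<lambda>y. {x \<in> K. f y < f x}) ` K"] by blast
  then obtain A where A: "finite A" "A \<subseteq> K" "\<F> = (\<lambda>y. {x \<in> K. f y < f x}) ` A"
    by (meson finite_subset_image)
  have "A \<noteq> {}" using F A K by auto
  then obtain y where y: "y \<in> A" "\<forall>z\<in>A. f y \<le> f z"
    using ex_is_arg_min_if_finite[OF A(1), of f] by (auto simp: is_arg_min_linorder)
  then have "y \<in> \<Union>\<F>" using F(3) A(2) by (meson subsetD)
  then obtain z where "z \<in> A" "f z < f y" unfolding A(3) by auto
  then show False using y(2) by (meson not_less)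
qed

text \<open>
  A strict inequality \<open>c < u x + g x\<close> leaves room for a number \<open>q\<close> with \<open>q < u x\<close> and \<open>c - q < g x\<close>.
\<close>

lemma lsc_add_continuous:
  fixes u g :: "'a \<Rightarrow> real"
  assumes u: "\<And>c. openin (subtopology X S) {x \<in> S. c < u x}"
    and g: "continuous_map (subtopology X S) euclideanreal g" and "S \<subseteq> topspace X"
  shows "openin (subtopology X S) {x \<in> S. c < u x + g x}"
proof -
  have "openin (subtopology X S) {x \<in> topspace (subtopology X S). g x \<in> {c - q<..}}" for q
    by (rule openin_continuous_map_preimage[OF g]) auto
  moreover have "topspace (subtopology X S) = S" using assms(3) by auto
  ultimately have "openin (subtopology X S) {x \<in> S. c - q < g x}" for q
    by (simp only: greaterThan_iff)
  then have "openin (subtopology X S) (\<Union>q. {x \<in> S. q < u x} \<inter> {x \<in> S. c - q < g x})"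
    by (intro openin_Union) (auto intro!: openin_Int u)
  moreover have "(\<Union>q. {x \<in> S. q < u x} \<inter> {x \<in> S. c - q < g x}) = {x \<in> S. c < u x + g x}"
  proof (safe; clarsimp)
    fix x assume "c < u x + g x"
    then obtain q where "c - g x < q" "q < u x" using dense[of "c - g x" "u x"] by auto
    then show "\<exists>q. q < u x \<and> c - q < g x" by (intro exI[of _ q]) auto
  qed
  ultimately show ?thesis by simp
qed

lemma lsc_subset:
  fixes u :: "'a \<Rightarrow> real"
  assumes "openin (subtopology X S) {x \<in> S. c < u x}" and "K \<subseteq> S"
  shows "openin (subtopology X K) {x \<in> K. c < u x}"
proof -
  obtain T where "openin X T" "{x \<in> S. c < u x} = T \<inter> S"
    using assms(1) by (auto simp: openin_subtopology)
  then have "{x \<in> K. c < u x} = T \<inter> K" using assms(2) by blast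
  then show ?thesis using \<open>openin X T\<close> by (auto simp: openin_subtopology)
qed

lemma closedin_eball:
  "closedin (Euclidean_space N) {y \<in> topspace (Euclidean_space N). edist N x y \<le> R}"
  using closedin_continuous_map_preimage[OF continuous_map_edist, of "{..R}" N x] by simp

text \<open>
  The segment from \<open>x\<close> to a point outside \<open>\<omega>\<close> is connected, so it meets the frontier, and it does so
  no farther from \<open>x\<close> than its endpoint.
\<close>

lemma eball_subset:
  assumes x: "x \<in> \<omega>" and op: "openin (Euclidean_space N) \<omega>"
    and R: "\<And>z. z \<in> Euclidean_space N frontier_of \<omega> \<Longrightarrow> R < edist N x z"
  shows "{y \<in> topspace (Euclidean_space N). edist N x y \<le> R} \<subseteq> \<omega>"
proof (rule subsetI, rule ccontr)
  fix y assume y: "y \<in> {y \<in> topspace (Euclidean_space N). edist N x y \<le> R}" and "y \<notin> \<omega>"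
  have xt: "x \<in> topspace (Euclidean_space N)" using x op openin_subset by blast
  define \<sigma> where "\<sigma> = (\<lambda>(s::real) i. x i + s * (y i - x i))"
  have "continuous_map (top_of_set {0..1}) (Euclidean_space N) \<sigma>"
    unfolding Euclidean_space_def continuous_map_in_subtopology continuous_map_componentwise_UNIV
    using xt y by (auto simp: \<sigma>_def topspace_Euclidean_space intro!: continuous_intros)
  then have "connectedin (Euclidean_space N) (\<sigma> ` {0..1})"
    by (rule connectedin_continuous_map_image) (simp add: connectedin_subtopology)
  moreover have "\<sigma> 0 = x" "\<sigma> 1 = y" by (auto simp: \<sigma>_def)
  then have "\<sigma> ` {0..1} \<inter> \<omega> \<noteq> {}" "\<sigma> ` {0..1} - \<omega> \<noteq> {}"
    using x \<open>y \<notin> \<omega>\<close> by (metis IntI image_eqI atLeastAtMost_iff empty_iff order_refl zero_le_one,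
      metis DiffI image_eqI atLeastAtMost_iff empty_iff order_refl zero_le_one)
  ultimately have "\<sigma> ` {0..1} \<inter> Euclidean_space N frontier_of \<omega> \<noteq> {}"
    by (rule connectedin_Int_frontier_of)
  then obtain s where s: "0 \<le> s" "s \<le> 1" "\<sigma> s \<in> Euclidean_space N frontier_of \<omega>" by auto
  have "edist N x (\<sigma> s) = L2_set (\<lambda>i. s * (x i - y i)) {..<N}"
    unfolding edist_def L2_set_def by (simp add: \<sigma>_def power2_eq_square algebra_simps)
  also have "\<dots> = s * edist N x y"
    using s by (simp add: edist_def L2_set_right_distrib)
  also have "\<dots> \<le> 1 * edist N x y" using s by (intro mult_right_mono) (auto simp: edist_nonneg)
  finally have "edist N x (\<sigma> s) \<le> R" using y by simp
  then show False using R[OF s(3)] by simp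
qed

text \<open>
  The infimum that defines the distance is at least the minimum of the distance over the compact
  product of \<open>closure \<omega>\<close> and the frontier. That minimum is positive because \<open>closure \<omega>\<close> lies in the
  open set \<open>\<omega>'\<close>, which is disjoint from its frontier. The point \<open>z\<close> guarantees that the infimum is
  taken over a nonempty set.
\<close>

lemma esetdist_frontier:
  assumes cc: "compactly_contained N \<omega> \<omega>'" and op': "openin (Euclidean_space N) \<omega>'"
    and cc': "compactly_contained N \<omega>' \<Omega>" and op: "openin (Euclidean_space N) \<omega>"
    and x: "x \<in> \<omega>" and z: "z \<in> Euclidean_space N frontier_of \<omega>'"
  shows "0 < esetdist N \<omega> (Euclidean_space N frontier_of \<omega>')"
    and "esetdist N \<omega> (Euclidean_space N frontier_of \<omega>') \<le> edist N x z"
proof -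
  let ?E = "Euclidean_space N"
  let ?F = "?E frontier_of \<omega>'" and ?A = "?E closure_of \<omega>"
  let ?S = "{edist N x y | x y. x \<in> \<omega> \<and> y \<in> ?F}"
  have bdd: "bdd_below ?S" by (rule bdd_belowI[of _ 0]) (auto simp: edist_nonneg)
  show "esetdist N \<omega> ?F \<le> edist N x z"
    unfolding esetdist_def using x z bdd by (intro cInf_lower) auto
  have "compactin ?E ?F"
  proof (rule closed_compactin[OF _ _ closedin_frontier_of])
    show "compactin ?E (?E closure_of \<omega>')" using cc' by (simp add: compactly_contained_def)
    show "?F \<subseteq> ?E closure_of \<omega>'" by (simp add: frontier_of_def)
  qed
  moreover have "compactin ?E ?A" using cc by (simp add: compactly_contained_def)
  ultimately have comp: "compactin (prod_topology ?E ?E) (?A \<times> ?F)"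
    by (simp add: compactin_Times)
  have "continuous_map (prod_topology ?E ?E) euclideanreal (\<lambda>q. edist N (fst q) (snd q))"
    unfolding edist_def L2_set_def
    by (intro continuous_intros continuous_map_compose[OF continuous_map_fst continuous_map_coordinate, unfolded o_def]
      continuous_map_compose[OF continuous_map_snd continuous_map_coordinate, unfolded o_def]) auto
  then have "compact ((\<lambda>q. edist N (fst q) (snd q)) ` (?A \<times> ?F))"
    using image_compactin[OF comp] compactin_euclidean_iff by blast
  moreover have xA: "\<omega> \<subseteq> ?A" using op by (simp add: closure_of_subset openin_subset)
  then have "(\<lambda>q. edist N (fst q) (snd q)) ` (?A \<times> ?F) \<noteq> {}" using x z by blast
  ultimately have "\<exists>m\<in>(\<lambda>q. edist N (fst q) (snd q)) ` (?A \<times> ?F).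
      \<forall>m'\<in>(\<lambda>q. edist N (fst q) (snd q)) ` (?A \<times> ?F). m \<le> m'"
    by (rule compact_attains_inf)
  then obtain a f where af: "a \<in> ?A" "f \<in> ?F"
      and min: "\<And>a' f'. a' \<in> ?A \<Longrightarrow> f' \<in> ?F \<Longrightarrow> edist N a f \<le> edist N a' f'"
    by force
  have "edist N a f \<le> esetdist N \<omega> ?F"
    unfolding esetdist_def using x z xA by (intro cInf_greatest) (auto intro!: min)
  moreover have "a \<in> \<omega>'" using af cc by (auto simp: compactly_contained_def)
  then have "a \<noteq> f" using af op' frontier_of_openin[OF op'] by auto
  then have "edist N a f \<noteq> 0"
    using af edist_eq_0_iff by (metis closure_of_subset_topspace frontier_of_subset_topspace subsetD)
  ultimately show "0 < esetdist N \<omega> ?F" using edist_nonneg[of N a f] by linarith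
qed

lemma locally_bounded_compact:
  assumes lb: "locally_bounded_on N \<Omega> u" and K: "compactin (Euclidean_space N) K" "K \<subseteq> \<Omega>"
  shows "bounded (u ` K)"
proof -
  let ?\<U> = "{U. openin (Euclidean_space N) U \<and> bounded (u ` U)}"
  have "K \<subseteq> \<Union>?\<U>" using lb K(2) unfolding locally_bounded_on_def by blast
  then obtain \<F> where "finite \<F>" "\<F> \<subseteq> ?\<U>" "K \<subseteq> \<Union>\<F>"
    using compactinD[OF K(1), of ?\<U>] by blast
  then have "bounded (\<Union>U\<in>\<F>. u ` U)" by (intro bounded_UN) auto
  moreover have "u ` K \<subseteq> (\<Union>U\<in>\<F>. u ` U)" using \<open>K \<subseteq> \<Union>\<F>\<close> by blast
  ultimately show ?thesis by (rule bounded_subset)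
qed

section \<open>Comparison with the barrier\<close>

text \<open>
  At such a point the quadratic polynomial of \<open>ln_barrier_le_quadratic\<close> would touch \<open>u\<close> from below with
  slope \<open>1/(4\<rho>)\<close> and radial second derivative \<open>1/(8\<rho>\<^sup>2)\<close>, where \<open>\<rho> = \<epsilon> + |x - y|\<close>. Since
  \<open>1/(8\<rho>\<^sup>2) \<le> 1/(16\<rho>\<^sup>2) + 1 + C\<close> fails for \<open>\<rho> < \<epsilon> + R\<close> when
  \<open>\<epsilon> + R\<close> is as small as assumed, this contradicts the equation.
\<close>

lemma supersolution_no_interior_contact:
  assumes p: "0 < p" "p \<le> 2" and C: "0 \<le> C"
    and visc: "viscosity_supersolution N p C \<Omega> u"
    and K: "{y \<in> topspace (Euclidean_space N). edist N x y \<le> R} \<subseteq> \<Omega>"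
    and x: "x \<in> topspace (Euclidean_space N)"
    and y: "y \<in> topspace (Euclidean_space N)" "y \<noteq> x" "edist N x y < R"
    and \<epsilon>: "0 < \<epsilon>" "16 * (C + 1) * (\<epsilon> + R)\<^sup>2 \<le> 1"
    and min: "\<And>z. z \<in> topspace (Euclidean_space N) \<Longrightarrow> edist N x z \<le> R \<Longrightarrow>
      u y + ln (1 + edist N x y / \<epsilon>) / 4 \<le> u z + ln (1 + edist N x z / \<epsilon>) / 4"
  shows False
proof -
  let ?E = "Euclidean_space N"
  define s where "s = edist N x y"
  define \<rho> where "\<rho> = \<epsilon> + s"
  define e where "e = (\<lambda>i. (y i - x i) / s)"
  \<comment> \<open>The coefficients are those of \<open>ln_barrier_le_quadratic\<close>, multiplied by \<open>-1/4\<close>.\<close>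
  define \<alpha> where "\<alpha> = - 1 / (4 * \<rho>)"
  define \<gamma> where "\<gamma> = 1 / (2 * s * \<rho>)"
  define \<beta> where "\<beta> = 1 / (16 * \<rho>\<^sup>2) + \<gamma>"
  have s: "0 < s" using edist_eq_0_iff[OF x y(1)] y(2) edist_nonneg[of N x y] by (auto simp: s_def)
  have rho: "0 < \<rho>" "s \<le> \<rho>" using s \<epsilon> by (auto simp: \<rho>_def)
  have unit: "(\<Sum>j<N. (e j)\<^sup>2) = 1"
    using s by (simp add: e_def power_divide edist_sq[symmetric] s_def[symmetric] flip: sum_divide_distrib)
  \<comment> \<open>Inside the ball the minimum property is available; the bound on the radial component keeps
     \<open>z\<close> away from the vertex, as the quadratic bound requires.\<close>
  define U where "U = {z \<in> topspace ?E. edist N x z < R} \<inter> {z \<in> topspace ?E. \<bar>offset_along N e y z\<bar> < s / 2}"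
  have "openin ?E {z \<in> topspace ?E. edist N x z < R}"
    using openin_continuous_map_preimage[OF continuous_map_edist, of "{..<R}" N x] by simp
  moreover have "openin ?E {z \<in> topspace ?E. \<bar>offset_along N e y z\<bar> < s / 2}"
    using openin_continuous_map_preimage[OF continuous_map_real_abs[OF continuous_map_offset_along], of "{..<s/2}" N e y] by simp
  ultimately have "openin ?E U" unfolding U_def by blast
  moreover have "y \<in> U" using y s by (simp add: U_def offset_along_def)
  moreover have "U \<subseteq> \<Omega>" using K by (auto simp: U_def)
  moreover have "u y + quadratic_test N e y \<alpha> \<beta> \<gamma> z \<le> u z" if z: "z \<in> U" for z
  proof -
    define t where "t = offset_along N e y z"
    define D where "D = (edist N y z)\<^sup>2"
    have tD: "t\<^sup>2 \<le> D" unfolding t_def D_def by (rule offset_along_sq_le[OF unit])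
    have t: "\<bar>t\<bar> \<le> s / 2" using z by (simp add: U_def t_def)
    have xz: "(edist N x z)\<^sup>2 = s\<^sup>2 + 2 * s * t + D"
    proof -
      have st: "s * t = (\<Sum>j<N. (z j - y j) * (y j - x j))"
        unfolding t_def offset_along_def sum_distrib_left e_def using s by (intro sum.cong) auto
      have "(edist N x z)\<^sup>2 = (\<Sum>j<N. (y j - x j)\<^sup>2 + 2 * ((z j - y j) * (y j - x j)) + (z j - y j)\<^sup>2)"
        unfolding edist_sq by (rule sum.cong) (auto simp: power2_eq_square algebra_simps)
      also have "\<dots> = s\<^sup>2 + 2 * (s * t) + D"
        unfolding st unfolding D_def s_def edist_sq by (simp only: sum.distrib sum_distrib_left)
      finally show ?thesis by simp
    qed
    have "ln (1 + edist N x z / \<epsilon>) - ln (1 + s / \<epsilon>) = ln ((\<rho> - s + edist N x z) / \<rho>)"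
    proof -
      have "0 < 1 + edist N x z / \<epsilon>" "0 < 1 + s / \<epsilon>"
        using \<epsilon> s edist_nonneg[of N x z] by (auto intro!: add_pos_nonneg)
      then have "ln (1 + edist N x z / \<epsilon>) - ln (1 + s / \<epsilon>) = ln ((1 + edist N x z / \<epsilon>) / (1 + s / \<epsilon>))"
        by (simp add: ln_div)
      also have "(1 + edist N x z / \<epsilon>) / (1 + s / \<epsilon>) = (\<rho> - s + edist N x z) / \<rho>"
        using \<epsilon>(1) s by (simp add: \<rho>_def divide_simps)
      finally show ?thesis .
    qed
    also have "\<dots> \<le> t / \<rho> - t\<^sup>2 / (4 * \<rho>\<^sup>2) + 2 * (D - t\<^sup>2) / (s * \<rho>)"
      by (rule ln_barrier_le_quadratic[OF s rho(2) t tD edist_nonneg xz])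
    also have "\<dots> = - 4 * quadratic_test N e y \<alpha> \<beta> \<gamma> z"
    proof -
      have q: "quadratic_test N e y \<alpha> \<beta> \<gamma> z = \<alpha> * t + \<beta> * t\<^sup>2 - \<gamma> * D"
        by (simp add: quadratic_test_def t_def D_def edist_sq)
      show ?thesis unfolding q unfolding \<alpha>_def \<beta>_def \<gamma>_def
        by (simp add: algebra_simps add_divide_distrib diff_divide_distrib)
    qed
    finally show ?thesis
      using min[of z] z by (simp add: U_def s_def)
  qed
  ultimately have "2 * (\<beta> - \<gamma>) \<le> \<bar>\<alpha>\<bar> powr p + C"
    using supersolution_quadratic[OF visc _ _ _ unit] by metis
  moreover have "\<bar>\<alpha>\<bar> powr p \<le> \<alpha>\<^sup>2 + 1"
  proof (cases "\<bar>\<alpha>\<bar> \<le> 1")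
    case True
    then have "\<bar>\<alpha>\<bar> powr p \<le> 1" using p by (intro powr_le1) auto
    then show ?thesis by (smt (verit) zero_le_power2)
  next
    case False
    then have "\<bar>\<alpha>\<bar> powr p \<le> \<bar>\<alpha>\<bar> powr 2" using p by (intro powr_mono) auto
    then show ?thesis using False by simp
  qed
  ultimately have "1 / (8 * \<rho>\<^sup>2) \<le> 1 / (16 * \<rho>\<^sup>2) + 1 + C"
    by (simp add: \<beta>_def \<alpha>_def power_mult_distrib power_divide)
  then have "1 \<le> 16 * (C + 1) * \<rho>\<^sup>2" using rho by (simp add: field_simps)
  moreover have "\<rho>\<^sup>2 < (\<epsilon> + R)\<^sup>2" using rho y by (intro power_strict_mono) (auto simp: \<rho>_def s_def)
  then have "16 * (C + 1) * \<rho>\<^sup>2 < 16 * (C + 1) * (\<epsilon> + R)\<^sup>2" using C by simp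
  ultimately show False using \<epsilon> by linarith
qed

text \<open>
  Minimising \<open>u\<close> plus the barrier over the closed ball leaves the centre as a minimum point: on the
  sphere the barrier outweighs the oscillation of \<open>u\<close>, and elsewhere contact is impossible.
\<close>

lemma supersolution_one_sided_bound:
  assumes p: "0 < p" "p \<le> 2" and C: "0 \<le> C"
    and visc: "viscosity_supersolution N p C \<Omega> u" and lsc: "u \<in> LSC N \<Omega>"
    and comp: "compactin (Euclidean_space N) {y \<in> topspace (Euclidean_space N). edist N x y \<le> R}"
    and K: "{y \<in> topspace (Euclidean_space N). edist N x y \<le> R} \<subseteq> \<Omega>"
    and x: "x \<in> topspace (Euclidean_space N)"
    and y: "y \<in> topspace (Euclidean_space N)" "edist N x y \<le> R"
    and bound: "\<And>z. z \<in> topspace (Euclidean_space N) \<Longrightarrow> edist N x z \<le> R \<Longrightarrow> \<bar>u z\<bar> \<le> M"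
    and \<epsilon>: "0 < \<epsilon>" "16 * (C + 1) * (\<epsilon> + R)\<^sup>2 \<le> 1" "2 * M \<le> ln (1 + R / \<epsilon>) / 4"
  shows "u x - u y \<le> edist N x y / (4 * \<epsilon>)"
proof -
  let ?E = "Euclidean_space N"
  let ?K = "{y \<in> topspace ?E. edist N x y \<le> R}"
  let ?w = "\<lambda>z. ln (1 + edist N x z / \<epsilon>) / 4"
  have xx: "edist N x x = 0" by (simp add: edist_def L2_set_def)
  have R: "0 \<le> R" using y edist_nonneg[of N x y] by linarith
  have xK: "x \<in> ?K" using x xx R by simp
  have pos: "0 < 1 + edist N x z / \<epsilon>" for z
    using \<epsilon> edist_nonneg[of N x z] by (auto intro!: add_pos_nonneg)
  have "continuous_map ?E (top_of_set {0..}) (edist N x)"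
    by (simp add: continuous_map_in_subtopology continuous_map_edist edist_nonneg image_subset_iff)
  moreover have "continuous_map (top_of_set {0..}) euclideanreal (\<lambda>r. ln (1 + r / \<epsilon>) / 4)"
  proof -
    have "1 + r / \<epsilon> \<noteq> 0" if "0 \<le> r" for r
      using that \<epsilon> by (smt (verit) divide_nonneg_pos)
    then show ?thesis using \<epsilon>(1) by (auto intro!: continuous_intros)
  qed
  ultimately have w: "continuous_map ?E euclideanreal ?w"
    using continuous_map_compose[of ?E "top_of_set {0..}" "edist N x" euclideanreal
        "\<lambda>r. ln (1 + r / \<epsilon>) / 4"] by (simp only: o_def)
  have "openin (subtopology ?E ?K) {z \<in> ?K. c < u z}" for c
    using lsc by (intro lsc_subset[OF _ K]) (simp add: LSC_def)
  then have "openin (subtopology ?E ?K) {z \<in> ?K. c < u z + ?w z}" for c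
    by (rule lsc_add_continuous[OF _ continuous_map_from_subtopology[OF w]]) simp
  then have "\<exists>m\<in>?K. \<forall>z\<in>?K. u m + ?w m \<le> u z + ?w z"
    using xK by (intro lsc_attains_min[OF comp]) auto
  then obtain m where m: "m \<in> ?K" and min: "\<And>z. z \<in> ?K \<Longrightarrow> u m + ?w m \<le> u z + ?w z"
    by blast
  have "u x + ?w x \<le> u m + ?w m"
  proof (cases "m = x \<or> edist N x m = R")
    case True
    then show ?thesis
      using bound[of m] bound[of x] m xK \<epsilon>(3) xx by auto
  next
    case False
    then have "m \<noteq> x" "edist N x m < R" using m by auto
    then show ?thesis
      using supersolution_no_interior_contact[OF p C visc K x _ _ _ \<epsilon>(1,2)] m min by blast
  qed
  also have "\<dots> \<le> u y + ?w y" using min y by simp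
  finally have "u x - u y \<le> ?w y" using xx by simp
  also have "\<dots> \<le> edist N x y / \<epsilon> / 4"
    using \<epsilon> edist_nonneg[of N x y] by (intro divide_right_mono ln_add_one_self_le_self) auto
  finally show ?thesis by (simp add: mult.commute)
qed

section \<open>The Lipschitz estimate\<close>

theorem proposition2p3:
  fixes p C d M :: real
  assumes "0 < p" and "p \<le> 2" and "0 \<le> C"
  shows "\<exists>L>0. \<forall>(N::nat) (\<Omega>::(nat \<Rightarrow> real) set) (u::(nat \<Rightarrow> real) \<Rightarrow> real)
           (\<omega>::(nat \<Rightarrow> real) set) (\<omega>'::(nat \<Rightarrow> real) set).
           1 \<le> N \<longrightarrow>
           domain_in N \<Omega> \<longrightarrow>
           u \<in> LSC N \<Omega> \<longrightarrow>
           locally_bounded_on N \<Omega> u \<longrightarrow>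
           viscosity_supersolution N p C \<Omega> u \<longrightarrow>
           openin (Euclidean_space N) \<omega> \<longrightarrow>
           openin (Euclidean_space N) \<omega>' \<longrightarrow>
           compactly_contained N \<omega> \<omega>' \<longrightarrow>
           compactly_contained N \<omega>' \<Omega> \<longrightarrow>
           esetdist N \<omega> (Euclidean_space N frontier_of \<omega>') = d \<longrightarrow>
           sup_norm \<omega>' u = M \<longrightarrow>
           (\<forall>x\<in>\<omega>. \<forall>y\<in>\<omega>. \<bar>u x - u y\<bar> \<le> L * edist N x y)"
proof -
  \<comment> \<open>If \<open>\<omega>\<close> is nonempty and \<open>\<omega>'\<close> has a frontier, then \<open>0 < d\<close>. Without a frontier \<open>d\<close> is an
     infimum over the empty set, of unknown value; every ball is then contained in \<open>\<omega>'\<close>, and the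
     fallback \<open>1\<close> is as good as any other radius. The second bound makes \<open>\<epsilon> + R\<close> small enough for
     the barrier.\<close>
  define R where "R = min (if 0 < d then d / 2 else 1) (1 / (16 * (C + 1)))"
  \<comment> \<open>This makes \<open>ln (R/\<epsilon>) / 4\<close> equal to \<open>2|M|\<close>. The absolute value matters only when \<open>\<omega>'\<close> is empty,
     for then nothing is known about the sign of \<open>M\<close>.\<close>
  define \<epsilon> where "\<epsilon> = R * exp (- 8 * \<bar>M\<bar>)"
  define L where "L = 1 / (4 * \<epsilon>) + 2 * \<bar>M\<bar> / R"
  have R: "0 < R" "R \<le> 1 / (16 * (C + 1))" using assms by (auto simp: R_def)
  have \<epsilon>: "0 < \<epsilon>" "\<epsilon> \<le> R" using R by (auto simp: \<epsilon>_def)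
  have L: "0 < L" using R \<epsilon> by (auto simp: L_def intro!: add_pos_nonneg)
  have small: "16 * (C + 1) * (\<epsilon> + R)\<^sup>2 \<le> 1"
  proof -
    have "\<epsilon> + R \<le> 2 * (1 / (16 * (C + 1)))" using R \<epsilon> by linarith
    then have "(\<epsilon> + R)\<^sup>2 \<le> (1 / (8 * (C + 1)))\<^sup>2" using R \<epsilon> assms by (intro power_mono) (auto simp: field_simps)
    then have "16 * (C + 1) * (\<epsilon> + R)\<^sup>2 \<le> 16 * (C + 1) * (1 / (8 * (C + 1)))\<^sup>2"
      using assms by (intro mult_left_mono) auto
    also have "\<dots> = 1 / (4 * (C + 1))" using assms by (simp add: power2_eq_square divide_simps) (simp add: algebra_simps)
    also have "\<dots> \<le> 1" using assms by simp
    finally show ?thesis .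
  qed
  have large: "2 * \<bar>M\<bar> \<le> ln (1 + R / \<epsilon>) / 4"
  proof -
    have "8 * \<bar>M\<bar> = ln (exp (8 * \<bar>M\<bar>))" by simp
    also have "\<dots> \<le> ln (1 + exp (8 * \<bar>M\<bar>))"
      by (subst ln_le_cancel_iff) (auto intro: add_pos_pos)
    also have "exp (8 * \<bar>M\<bar>) = R / \<epsilon>" using R by (simp add: \<epsilon>_def exp_minus divide_inverse)
    finally show ?thesis by simp
  qed
  have main: "u x - u y \<le> L * edist N x y"
    if lsc: "u \<in> LSC N \<Omega>" and lb: "locally_bounded_on N \<Omega> u"
      and visc: "viscosity_supersolution N p C \<Omega> u"
      and op: "openin (Euclidean_space N) \<omega>" and op': "openin (Euclidean_space N) \<omega>'"
      and cc: "compactly_contained N \<omega> \<omega>'" and cc': "compactly_contained N \<omega>' \<Omega>"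
      and d: "esetdist N \<omega> (Euclidean_space N frontier_of \<omega>') = d" and M: "sup_norm \<omega>' u = M"
      and x: "x \<in> \<omega>" and y: "y \<in> \<omega>"
    for N \<Omega> u \<omega> \<omega>' x y
  proof -
    let ?E = "Euclidean_space N"
    let ?K = "{y \<in> topspace ?E. edist N x y \<le> R}"
    have sub: "\<omega> \<subseteq> \<omega>'" "\<omega>' \<subseteq> ?E closure_of \<omega>'" "?E closure_of \<omega>' \<subseteq> \<Omega>"
      using op op' cc cc' closure_of_subset[OF openin_subset]
      by (auto simp: compactly_contained_def)
    have top: "x \<in> topspace ?E" "y \<in> topspace ?E" using op x y openin_subset by auto
    have comp: "compactin ?E (?E closure_of \<omega>')" using cc' by (simp add: compactly_contained_def)
    have "bounded (u ` \<omega>')"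
      using locally_bounded_compact[OF lb comp sub(3)] sub(2) by (meson bounded_subset image_mono)
    then have bound: "\<bar>u z\<bar> \<le> \<bar>M\<bar>" if "z \<in> \<omega>'" for z
      using that M unfolding sup_norm_def bounded_real
      by (smt (verit) bdd_aboveI2 cSUP_upper imageI)
    have KM: "?K \<subseteq> \<omega>'"
    proof (rule eball_subset[OF _ op'])
      fix z assume "z \<in> ?E frontier_of \<omega>'"
      from esetdist_frontier[OF cc op' cc' op x this] show "R < edist N x z"
        unfolding d by (simp add: R_def)
    qed (use sub x in auto)
    then have "compactin ?E ?K"
      using sub by (intro closed_compactin[OF comp _ closedin_eball]) auto
    show ?thesis
    proof (cases "edist N x y \<le> R")
      case True
      have "u x - u y \<le> edist N x y / (4 * \<epsilon>)"
        using KM sub top True bound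
        by (intro supersolution_one_sided_bound[OF assms visc lsc \<open>compactin ?E ?K\<close> _ _ _ _ _ \<epsilon>(1) small large]) auto
      also have "\<dots> \<le> L * edist N x y"
        using R edist_nonneg[of N x y] by (simp add: L_def distrib_right)
      finally show ?thesis .
    next
      case False
      have "u x - u y \<le> 2 * \<bar>M\<bar>" using bound[of x] bound[of y] x y sub(1) by fastforce
      also have "\<dots> \<le> 2 * \<bar>M\<bar> / R * edist N x y"
        using False R mult_left_mono[of R "edist N x y" "\<bar>M\<bar>"] by (simp add: field_simps)
      also have "\<dots> \<le> L * edist N x y"
        using \<epsilon> edist_nonneg[of N x y] by (simp add: L_def distrib_right)
      finally show ?thesis .
    qed
  qed
  show ?thesis
  proof (intro exI[of _ L] conjI allI impI ballI L)
    fix N \<Omega> u \<omega> \<omega>' x y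
    assume *: "u \<in> LSC N \<Omega>" "locally_bounded_on N \<Omega> u" "viscosity_supersolution N p C \<Omega> u"
      "openin (Euclidean_space N) \<omega>" "openin (Euclidean_space N) \<omega>'"
      "compactly_contained N \<omega> \<omega>'" "compactly_contained N \<omega>' \<Omega>"
      "esetdist N \<omega> (Euclidean_space N frontier_of \<omega>') = d" "sup_norm \<omega>' u = M"
      and xy: "x \<in> \<omega>" "y \<in> \<omega>"
    show "\<bar>u x - u y\<bar> \<le> L * edist N x y"
      using main[OF * xy] main[OF * xy(2,1)] by (simp add: abs_le_iff edist_commute)
  qed
qed

end
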